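(* Let $m\ge2$ and let $A$ be an axis-aligned $2m$-gon in $\mathbb{R}^2$ with vertices, in cyclic order, $$(x_1,y_{2m}),\ (x_1,y_2),\ (x_3,y_2),\ (x_3,y_4),\ (x_5,y_4),\ \ldots,\ (x_{2m-1},y_{2m}),$$ that is, $A_{2i}=(x_{2i-1},y_{2i})$ and $A_{2i+1}=(x_{2i+1},y_{2i})$ with all indices taken modulo $2m$, where no three consecutive vertices are collinear (equivalently $x_{2i-1}\neq x_{2i+1}$ and $y_{2i}\ne y_{2i+2}$ for all $i$, indices modulo $2m$). Then the linear map $L_A:\mathbb{R}^3\to\mathbb{R}^3$ is given in matrix form (in the standard basis) by $$L_A=\begin{bmatrix} m & 0 & x_1+x_3+\cdots+x_{2m-1}\\ 0 & m & y_2+y_4+\cdots+y_{2m}\\ 0&0&2m\end{bmatrix}.$$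
   Context: For an $n$-tuple $A=(A_1,\ldots,A_n)$ of points of $\mathbb{R}^2$ with no three consecutive points collinear (indices modulo $n$), let $u_j\in\mathbb{R}^3$ be the lift of $A_j$ obtained by appending a third coordinate equal to $1$. The linear map $L_A:\mathbb{R}^3\to\mathbb{R}^3$ is defined by $$L_A(v)=nv-\sum_{j=1}^n\frac{|u_{j-1},v,u_{j+1}|}{|u_{j-1},u_j,u_{j+1}|}\,u_j,$$ where $|\cdot,\cdot,\cdot|$ is the determinant of three vectors. Here $n=2m$. *)

theory Defs
  imports "HOL-Analysis.Analysis"
begin

text \<open>
  An \<open>n\<close>-tuple is a function on \<^typ>\<open>nat\<close> of which only the values at \<open>1, \<dots>, n\<close> are used.
  Indices modulo \<open>n\<close> are reduced to representatives in \<open>{1..n}\<close>; in particular \<open>0\<close> becomes \<open>n\<close>.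
\<close>

definition cyc :: "nat \<Rightarrow> nat \<Rightarrow> nat" where
  "cyc n k = (if k mod n = 0 then n else k mod n)"

definition no_three_consecutive_collinear :: "nat \<Rightarrow> (nat \<Rightarrow> real^2) \<Rightarrow> bool" where
  "no_three_consecutive_collinear n A \<longleftrightarrow>
     (\<forall>j\<in>{1..n}. \<not> collinear {A (cyc n (j - 1)), A j, A (cyc n (j + 1))})"

definition lift :: "real^2 \<Rightarrow> real^3" where
  "lift P = vector [P $ 1, P $ 2, 1]"

definition det3 :: "real^3 \<Rightarrow> real^3 \<Rightarrow> real^3 \<Rightarrow> real" where
  "det3 a b c = det (vector [a, b, c] :: real^3^3)"

definition L_map :: "nat \<Rightarrow> (nat \<Rightarrow> real^2) \<Rightarrow> real^3 \<Rightarrow> real^3" where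
  "L_map n A v =
     real n *\<^sub>R v -
     (\<Sum>j=1..n.
        (det3 (lift (A (cyc n (j - 1)))) v (lift (A (cyc n (j + 1)))) /
         det3 (lift (A (cyc n (j - 1)))) (lift (A j)) (lift (A (cyc n (j + 1))))) *\<^sub>R
        lift (A j))"

text \<open>
  Only the odd-indexed values of \<open>x\<close> and the even-indexed values of \<open>y\<close> are used.
  The first vertex \<open>(x\<^sub>1, y\<^sub>2\<^sub>m)\<close> is the second clause at \<open>i = m\<close>.
\<close>

definition axis_aligned_polygon ::
    "nat \<Rightarrow> (nat \<Rightarrow> real) \<Rightarrow> (nat \<Rightarrow> real) \<Rightarrow> (nat \<Rightarrow> real^2) \<Rightarrow> bool" where
  "axis_aligned_polygon m x y A \<longleftrightarrow>
     (\<forall>i\<in>{1..m}.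
        A (2*i) = vector [x (2*i - 1), y (2*i)] \<and>
        A (cyc (2*m) (2*i + 1)) = vector [x (cyc (2*m) (2*i + 1)), y (2*i)])"

end

theory Submission
  imports Defs
begin

text \<open>
  The coefficient of \<open>u\<^sub>j\<close> in \<open>L\<^sub>A\<close> is the affine function that is \<open>1\<close> at \<open>A\<^sub>j\<close> and vanishes on
  the line through its two neighbours. For a corner with axis-parallel legs this function is the
  constant \<open>1\<close> plus one summand per leg, so the sum over the vertices becomes a sum over the edges,
  and at each edge the denominators cancel between its two end points.
\<close>

text \<open>Vertices are handled in pairs \<open>2*i + 1\<close>, \<open>2*i + 2\<close>. In the
  polygon the first of a pair is entered along a horizontal edge and left along a vertical one, the
  second the other way round, so each parity has one uniform formula.\<close>

lemma Ball_atLeastAtMost_double: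
  "(\<forall>j\<in>{1..2*m}. Q j) \<longleftrightarrow> (\<forall>i<m. Q (2*i + 1) \<and> Q (2*i + 2))" for m :: nat
proof
  assume R: "\<forall>i<m. Q (2*i + 1) \<and> Q (2*i + 2)"
  show "\<forall>j\<in>{1..2*m}. Q j"
  proof
    fix j assume "j \<in> {1..2*m}"
    then have "(j - 1) div 2 < m" "j = 2 * ((j - 1) div 2) + 1 \<or> j = 2 * ((j - 1) div 2) + 2"
      by auto
    with R show "Q j" by metis
  qed
qed auto

lemma sum_atLeastAtMost_double:
  "(\<Sum>j=1..2*m. f j) = (\<Sum>i<m. f (2*i + 1) + f (2*i + 2))"
  for f :: "nat \<Rightarrow> 'a::comm_monoid_add"
  by (induction m) (auto simp: add.assoc)

lemma sum_Suc_periodic: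
  fixes f :: "nat \<Rightarrow> 'a::ab_group_add"
  assumes "f m = f 0"
  shows "(\<Sum>i<m. f (Suc i)) = (\<Sum>i<m. f i)"
  using sum_lessThan_telescope[of f m] assms by (simp add: sum_subtractf)

lemma cyc_eq_self: "1 \<le> k \<Longrightarrow> k \<le> n \<Longrightarrow> cyc n k = k"
  by (cases "k = n") (auto simp: cyc_def)

lemma cyc_add_self: "cyc n (n + k) = cyc n k"
  by (simp add: cyc_def)

lemma lift_vector: "lift (vector [p, q]) = vector [p, q, 1]"
  by (simp add: lift_def)

lemma det3_expand:
  "det3 a b c = a$1 * b$2 * c$3 + a$2 * b$3 * c$1 + a$3 * b$1 * c$2
     - a$1 * b$3 * c$2 - a$2 * b$1 * c$3 - a$3 * b$2 * c$1"
  by (simp add: det3_def det_3)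

lemma det3_swap: "det3 c b a = - det3 a b c"
  by (simp add: det3_expand)

lemma collinear_corner_iff:
  "collinear {vector [p, q'], vector [p, q], vector [p', q] :: real^2} \<longleftrightarrow> p = p' \<or> q = q'"
proof -
  \<comment> \<open>Here \<open>u\<close> is the parameter that places the corner on the line
    through its neighbours. If both legs are nondegenerate, the first coordinate forces
    \<open>u = 1\<close> and the second \<open>u = 0\<close>, a contradiction.\<close>
  have *: "p = u * p + (1 - u) * p' \<longleftrightarrow> u = 1 \<or> p = p'"
    "q = u * q' + (1 - u) * q \<longleftrightarrow> u = 0 \<or> q = q'" for u
    by algebra+
  show ?thesis
    unfolding collinear_3_expand vec_eq_iff forall_2 by (auto simp: *)
qed

lemma collinear_corner_iff_reversed:
  "collinear {vector [p', q], vector [p, q], vector [p, q'] :: real^2} \<longleftrightarrow> p = p' \<or> q = q'"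
  using collinear_corner_iff[of p q' q p'] by (simp add: insert_commute)

text \<open>Both sides are linear in \<open>v\<close>, with value 1 at the lifted corner and 0 at
  its two lifted neighbours. These three vectors form a basis, since their determinant is
  \<open>(p - p') * (q - q')\<close>.\<close>

lemma det3_corner_ratio:
  assumes "p \<noteq> p'" "q \<noteq> q'"
  shows "det3 (lift (vector [p, q'])) v (lift (vector [p', q])) /
         det3 (lift (vector [p, q'])) (lift (vector [p, q])) (lift (vector [p', q]))
       = v$3 + (v$1 - p * v$3) / (p - p') + (v$2 - q * v$3) / (q - q')"
proof -
  have "det3 (lift (vector [p, q'])) (lift (vector [p, q])) (lift (vector [p', q]))
      = (p - p') * (q - q')"
    by (simp add: det3_expand lift_vector algebra_simps)
  moreover have "det3 (lift (vector [p, q'])) v (lift (vector [p', q])) =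
      (p - p') * (q - q') * v$3 + (q - q') * (v$1 - p * v$3) + (p - p') * (v$2 - q * v$3)"
    by (simp add: det3_expand lift_vector algebra_simps)
  ultimately show ?thesis
    using assms by (simp add: divide_simps) (simp add: algebra_simps)
qed

lemma det3_corner_ratio_reversed:
  assumes "p \<noteq> p'" "q \<noteq> q'"
  shows "det3 (lift (vector [p', q])) v (lift (vector [p, q'])) /
         det3 (lift (vector [p', q])) (lift (vector [p, q])) (lift (vector [p, q']))
       = v$3 + (v$1 - p * v$3) / (p - p') + (v$2 - q * v$3) / (q - q')"
  \<comment> \<open>Reversing the orientation changes the sign of both determinants. Fixing one
    outer argument of \<open>det3_swap\<close> keeps the rewriting from looping.\<close>
  using det3_corner_ratio[OF assms] by (simp add: det3_swap[of "lift (vector [p, q'])"])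

text \<open>The left side is the divided difference at \<open>p\<close>, \<open>p'\<close> of the
  map sending \<open>t\<close> to \<open>(a - t * c)\<close> times \<open>(t, q, 1)\<close>. Its
  entries are polynomials in \<open>t\<close> of degree at most 2, so the denominator cancels.
  Vertical edges behave likewise in the other coordinate.\<close>

lemma horizontal_edge_sum:
  assumes "p \<noteq> p'"
  shows "((a - p * c) / (p - p')) *\<^sub>R (vector [p, q, 1] :: real^3) +
         ((a - p' * c) / (p' - p)) *\<^sub>R vector [p', q, 1]
       = vector [a - c * (p + p'), - c * q, - c]"
  using assms unfolding vec_eq_iff forall_3
  by (simp add: divide_simps) (simp add: algebra_simps)

lemma vertical_edge_sum:
  assumes "q \<noteq> q'"
  shows "((b - q * c) / (q - q')) *\<^sub>R (vector [p, q, 1] :: real^3) +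
         ((b - q' * c) / (q' - q)) *\<^sub>R vector [p, q', 1]
       = vector [- c * p, b - c * (q + q'), - c]"
  using assms unfolding vec_eq_iff forall_3
  by (simp add: divide_simps) (simp add: algebra_simps)

lemma sum_staircase_corners:
  fixes X Y :: "nat \<Rightarrow> real" and v :: "real^3"
  defines "w \<equiv> \<lambda>i k. vector [X i, Y k, 1] :: real^3"
  assumes ne: "\<And>i. i \<le> m \<Longrightarrow> X i \<noteq> X (Suc i)" "\<And>i. i \<le> m \<Longrightarrow> Y i \<noteq> Y (Suc i)"
    and per: "X m = X 0" "X (Suc m) = X 1" "Y m = Y 0"
  shows "(\<Sum>i<m.
      (v$3 + (v$1 - X (Suc i) * v$3) / (X (Suc i) - X i)
           + (v$2 - Y i * v$3) / (Y i - Y (Suc i))) *\<^sub>R w (Suc i) i +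
      (v$3 + (v$1 - X (Suc i) * v$3) / (X (Suc i) - X (Suc (Suc i)))
           + (v$2 - Y (Suc i) * v$3) / (Y (Suc i) - Y i)) *\<^sub>R w (Suc i) (Suc i))
    = vector [m * v$1 - v$3 * (\<Sum>i<m. X (Suc i)), m * v$2 - v$3 * (\<Sum>i<m. Y (Suc i)), 0]"
    (is "?S = ?R")
proof -
  \<comment> \<open>\<open>H i\<close> and \<open>H' i\<close> are the contributions of the
    horizontal edge from \<open>w i i\<close> to \<open>w (Suc i) i\<close> at its two ends;
    \<open>V i\<close> and \<open>V' i\<close> are those of the vertical edge from
    \<open>w (Suc i) i\<close> to \<open>w (Suc i) (Suc i)\<close>.\<close>
  define H where "H i = ((v$1 - X i * v$3) / (X i - X (Suc i))) *\<^sub>R w i i" for i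
  define H' where "H' i = ((v$1 - X (Suc i) * v$3) / (X (Suc i) - X i)) *\<^sub>R w (Suc i) i" for i
  define V where "V i = ((v$2 - Y i * v$3) / (Y i - Y (Suc i))) *\<^sub>R w (Suc i) i" for i
  define V' where
    "V' i = ((v$2 - Y (Suc i) * v$3) / (Y (Suc i) - Y i)) *\<^sub>R w (Suc i) (Suc i)" for i
  \<comment> \<open>A pair of corners contains a whole vertical edge, but only the end of one
    horizontal edge and the start of the next. Periodicity moves that start back by one index, so
    that \<open>H i\<close> meets \<open>H' i\<close>.\<close>
  have shift: "(\<Sum>i<m. H (Suc i)) = (\<Sum>i<m. H i)"
    by (rule sum_Suc_periodic) (simp add: H_def w_def per)
  have "?S = (\<Sum>i<m. v$3 *\<^sub>R (w (Suc i) i + w (Suc i) (Suc i)) + (V i + V' i) + H' i + H (Suc i))"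
    by (simp add: H_def H'_def V_def V'_def algebra_simps)
  also have "\<dots> = (\<Sum>i<m. v$3 *\<^sub>R (w (Suc i) i + w (Suc i) (Suc i)) + (V i + V' i) + (H i + H' i))"
    by (simp add: sum.distrib shift)
  also have "\<dots> = (\<Sum>i<m. vector [v$1 - v$3 * X i, v$2 - v$3 * Y i, 0])"
  proof (rule sum.cong)
    fix i assume "i \<in> {..<m}"
    then have V: "V i + V' i = vector [- v$3 * X (Suc i), v$2 - v$3 * (Y i + Y (Suc i)), - v$3]"
      and H: "H i + H' i = vector [v$1 - v$3 * (X i + X (Suc i)), - v$3 * Y i, - v$3]"
      unfolding V_def V'_def H_def H'_def w_def
      by (intro vertical_edge_sum horizontal_edge_sum; use ne in simp)+
    \<comment> \<open>In the third coordinate the constants of the two corners give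
      \<open>2 * v$3\<close>, and each of the two edges takes away \<open>v$3\<close>.\<close>
    show "v$3 *\<^sub>R (w (Suc i) i + w (Suc i) (Suc i)) + (V i + V' i) + (H i + H' i)
        = vector [v$1 - v$3 * X i, v$2 - v$3 * Y i, 0]"
      unfolding V H by (simp add: w_def vec_eq_iff forall_3 algebra_simps)
  qed simp
  also have "\<dots> = ?R"
    using sum_Suc_periodic[of X m] sum_Suc_periodic[of Y m] per
    by (simp add: vec_eq_iff forall_3 sum_subtractf sum_distrib_left)
  finally show ?thesis .
qed

theorem proposition5p1:
  fixes m :: nat and x y :: "nat \<Rightarrow> real" and A :: "nat \<Rightarrow> real^2"
  assumes "m \<ge> 2"
    and "axis_aligned_polygon m x y A"
  shows "(no_three_consecutive_collinear (2*m) A \<longleftrightarrow>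
           (\<forall>i\<in>{1..m}. x (2*i - 1) \<noteq> x (cyc (2*m) (2*i + 1)) \<and>
                       y (2*i) \<noteq> y (cyc (2*m) (2*i + 2)))) \<and>
         (no_three_consecutive_collinear (2*m) A \<longrightarrow>
           linear (L_map (2*m) A) \<and>
           matrix (L_map (2*m) A) =
             (vector [vector [real m, 0, \<Sum>i=1..m. x (2*i - 1)],
                      vector [0, real m, \<Sum>i=1..m. y (2*i)],
                      vector [0, 0, 2 * real m]] :: real^3^3))"
proof -
  \<comment> \<open>\<open>B\<close> extends the polygon periodically to all indices.
    \<open>X i\<close> and \<open>Y i\<close> stand for \<open>x (2*i - 1)\<close> and
    \<open>y (2*i)\<close> but also make sense at 0 and beyond \<open>m\<close>, which removes most
    uses of \<open>cyc\<close> from the later steps.\<close>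
  define B where "B k = A (cyc (2*m) k)" for k
  define X where "X i = B (2*i) $ 1" for i
  define Y where "Y i = B (2*i) $ 2" for i
  have poly: "A (2*i) = vector [x (2*i - 1), y (2*i)]"
    "A (cyc (2*m) (2*i + 1)) = vector [x (cyc (2*m) (2*i + 1)), y (2*i)]" if "i \<in> {1..m}" for i
    using assms(2) that unfolding axis_aligned_polygon_def by blast+
  have B_per: "B (2*m + k) = B k" for k
    by (simp add: B_def cyc_add_self)
  have X_per: "X (m + i) = X i" and Y_per: "Y (m + i) = Y i" for i
    using B_per[of "2*i"] by (simp_all add: X_def Y_def algebra_simps)
  have B_self: "B k = A k" if "k \<in> {1..2*m}" for k
    using that by (simp add: B_def cyc_eq_self)
  have X_eq: "X i = x (2*i - 1)" and Y_eq: "Y i = y (2*i)" if "i \<in> {1..m}" for i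
    using that B_self[of "2*i"] poly(1)[OF that] by (simp_all add: X_def Y_def)
  have X_Suc_eq: "X (Suc i) = x (cyc (2*m) (2*i + 1))"
    and Y_Suc_eq: "Y (Suc i) = y (cyc (2*m) (2*i + 2))" if "i \<in> {1..m}" for i
  proof -
    have "X (Suc i) = x (cyc (2*m) (2*i + 1)) \<and> Y (Suc i) = y (cyc (2*m) (2*i + 2))"
    \<comment> \<open>Only \<open>i = m\<close> wraps around: there \<open>2*m + 1\<close> and
      \<open>2*m + 2\<close> reduce to 1 and 2.\<close>
    proof (cases "i = m")
      case True
      then show ?thesis
        using X_per[of 1] Y_per[of 1] X_eq[of 1] Y_eq[of 1] assms(1)
          cyc_add_self[of "2*m" 1] cyc_add_self[of "2*m" 2]
        by (simp add: cyc_eq_self)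
    next
      case False
      then show ?thesis using that X_eq[of "Suc i"] Y_eq[of "Suc i"] by (simp add: cyc_eq_self)
    qed
    then show "X (Suc i) = x (cyc (2*m) (2*i + 1))" "Y (Suc i) = y (cyc (2*m) (2*i + 2))"
      by auto
  qed
  have B_even: "B (2*i) = vector [X i, Y i]" for i
    by (simp add: X_def Y_def vec_eq_iff forall_2)
  have B_odd_pos: "B (2*i + 1) = vector [X (Suc i), Y i]" if "i \<in> {1..m}" for i
    using poly(2)[OF that] X_Suc_eq[OF that] Y_eq[OF that] by (simp add: B_def)
  have B_odd: "B (2*i + 1) = vector [X (Suc i), Y i]" if "i \<le> m" for i
  \<comment> \<open>The first vertex is described by the polygon clause at \<open>m\<close>, so
    \<open>i = 0\<close> is reached by going once around.\<close>
  proof (cases "i = 0")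
    case True
    then show ?thesis
      using B_odd_pos[of m] B_per[of 1] X_per[of 1] Y_per[of 0] assms(1) by simp
  qed (use B_odd_pos that in simp)

  have verts: "A (cyc (2*m) (2*i + 1 - 1)) = vector [X i, Y i]"
    "A (2*i + 1) = vector [X (Suc i), Y i]"
    "A (cyc (2*m) (2*i + 1 + 1)) = vector [X (Suc i), Y (Suc i)]"
    "A (cyc (2*m) (2*i + 2 - 1)) = vector [X (Suc i), Y i]"
    "A (2*i + 2) = vector [X (Suc i), Y (Suc i)]"
    "A (cyc (2*m) (2*i + 2 + 1)) = vector [X (Suc (Suc i)), Y (Suc i)]" if "i < m" for i
    using that B_even[of i] B_even[of "Suc i"] B_odd[of i] B_odd[of "Suc i"]
      B_self[of "2*i + 1"] B_self[of "2*i + 2"]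
    by (simp_all add: B_def)

  have per0: "X m = X 0" "X (Suc m) = X 1" "Y m = Y 0" "Y (Suc m) = Y 1"
    using X_per[of 0] X_per[of 1] Y_per[of 0] Y_per[of 1] by simp_all
  \<comment> \<open>The odd and the even corner of a pair share a vertical edge, so their four
    inequalities reduce to three.\<close>
  have "no_three_consecutive_collinear (2*m) A \<longleftrightarrow>
      (\<forall>i<m. X (Suc i) \<noteq> X i \<and> Y i \<noteq> Y (Suc i) \<and> X (Suc i) \<noteq> X (Suc (Suc i)))"
    unfolding no_three_consecutive_collinear_def Ball_atLeastAtMost_double
    by (auto simp only: verts collinear_corner_iff collinear_corner_iff_reversed) metis
  \<comment> \<open>What remains is one inequality per edge, with the indices shifted from a start
    at 0 to a start at 1; \<open>per0\<close> identifies edge 0 with edge \<open>m\<close>.\<close>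
  also have "\<dots> \<longleftrightarrow> (\<forall>i\<in>{1..m}. X i \<noteq> X (Suc i) \<and> Y i \<noteq> Y (Suc i))"
  proof (intro iffI ballI allI impI)
    fix i assume L: "\<forall>i<m. X (Suc i) \<noteq> X i \<and> Y i \<noteq> Y (Suc i) \<and> X (Suc i) \<noteq> X (Suc (Suc i))"
      and "i \<in> {1..m}"
    then obtain k where "i = Suc k" "k < m"
      by (cases i) auto
    then show "X i \<noteq> X (Suc i) \<and> Y i \<noteq> Y (Suc i)"
      using L[rule_format, of k] L[rule_format, of i] L[rule_format, of 0] per0
      by (cases "i = m") auto
  next
    fix i assume R: "\<forall>i\<in>{1..m}. X i \<noteq> X (Suc i) \<and> Y i \<noteq> Y (Suc i)" and "i < m"
    then show "X (Suc i) \<noteq> X i \<and> Y i \<noteq> Y (Suc i) \<and> X (Suc i) \<noteq> X (Suc (Suc i))"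
      using R[rule_format, of m] R[rule_format, of i] R[rule_format, of "Suc i"] per0
      by (cases "i = 0") (auto simp: eq_commute[of "X (Suc i)" "X i"])
  qed
  finally have nc: "no_three_consecutive_collinear (2*m) A \<longleftrightarrow>
    (\<forall>i\<in>{1..m}. X i \<noteq> X (Suc i) \<and> Y i \<noteq> Y (Suc i))" .

  let ?M = "vector [vector [real m, 0, \<Sum>i=1..m. x (2*i - 1)],
                    vector [0, real m, \<Sum>i=1..m. y (2*i)],
                    vector [0, 0, 2 * real m]] :: real^3^3"
  have "L_map (2*m) A = (*v) ?M" if "no_three_consecutive_collinear (2*m) A"
  proof
    fix v :: "real^3"
    have ne: "X i \<noteq> X (Suc i)" "Y i \<noteq> Y (Suc i)" if "i \<le> m" for i
    proof -
      have *: "X i \<noteq> X (Suc i) \<and> Y i \<noteq> Y (Suc i)" if "i \<in> {1..m}" for i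
        using nc \<open>no_three_consecutive_collinear (2*m) A\<close> that by blast
      have "X i \<noteq> X (Suc i) \<and> Y i \<noteq> Y (Suc i)"
        \<comment> \<open>The range now includes 0, whose inequalities are those at \<open>m\<close>
          by periodicity.\<close>
        using *[of i] *[of m] per0 that assms(1) by (cases "i = 0") auto
      then show "X i \<noteq> X (Suc i)" "Y i \<noteq> Y (Suc i)" by auto
    qed
    have sums: "(\<Sum>i<m. X (Suc i)) = (\<Sum>i=1..m. x (2*i - 1))"
      "(\<Sum>i<m. Y (Suc i)) = (\<Sum>i=1..m. y (2*i))"
      by (simp_all add: X_eq Y_eq sum.atLeast1_atMost_eq)
    have "L_map (2*m) A v = real (2*m) *\<^sub>R v - (\<Sum>i<m.
        (v$3 + (v$1 - X (Suc i) * v$3) / (X (Suc i) - X i)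
           + (v$2 - Y i * v$3) / (Y i - Y (Suc i))) *\<^sub>R vector [X (Suc i), Y i, 1] +
        (v$3 + (v$1 - X (Suc i) * v$3) / (X (Suc i) - X (Suc (Suc i)))
           + (v$2 - Y (Suc i) * v$3) / (Y (Suc i) - Y i)) *\<^sub>R vector [X (Suc i), Y (Suc i), 1])"
      unfolding L_map_def sum_atLeastAtMost_double
    proof (intro arg_cong[where f = "\<lambda>s. _ - s"] sum.cong refl)
      fix i assume "i \<in> {..<m}"
      then have i: "i < m" by simp
      then have ne': "X (Suc i) \<noteq> X i" "X (Suc i) \<noteq> X (Suc (Suc i))"
        "Y i \<noteq> Y (Suc i)" "Y (Suc i) \<noteq> Y i"
        using ne[of i] ne[of "Suc i"] by auto
      show "(det3 (lift (A (cyc (2*m) (2*i + 1 - 1)))) v (lift (A (cyc (2*m) (2*i + 1 + 1)))) /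
           det3 (lift (A (cyc (2*m) (2*i + 1 - 1)))) (lift (A (2*i + 1)))
             (lift (A (cyc (2*m) (2*i + 1 + 1))))) *\<^sub>R lift (A (2*i + 1)) +
          (det3 (lift (A (cyc (2*m) (2*i + 2 - 1)))) v (lift (A (cyc (2*m) (2*i + 2 + 1)))) /
           det3 (lift (A (cyc (2*m) (2*i + 2 - 1)))) (lift (A (2*i + 2)))
             (lift (A (cyc (2*m) (2*i + 2 + 1))))) *\<^sub>R lift (A (2*i + 2)) =
        (v$3 + (v$1 - X (Suc i) * v$3) / (X (Suc i) - X i)
           + (v$2 - Y i * v$3) / (Y i - Y (Suc i))) *\<^sub>R vector [X (Suc i), Y i, 1] +
        (v$3 + (v$1 - X (Suc i) * v$3) / (X (Suc i) - X (Suc (Suc i)))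
           + (v$2 - Y (Suc i) * v$3) / (Y (Suc i) - Y i)) *\<^sub>R vector [X (Suc i), Y (Suc i), 1]"
        \<comment> \<open>The odd vertex is entered horizontally and takes the reversed formula; the
          even vertex is entered vertically and takes the direct one.\<close>
        unfolding verts[OF i] det3_corner_ratio[OF ne'(2,4)] det3_corner_ratio_reversed[OF ne'(1,3)]
        by (simp only: lift_vector)
    qed
    also have "\<dots> = real (2*m) *\<^sub>R v - vector [m * v$1 - v$3 * (\<Sum>i=1..m. x (2*i - 1)),
        m * v$2 - v$3 * (\<Sum>i=1..m. y (2*i)), 0]"
      using ne per0 by (subst sum_staircase_corners) (auto simp: sums)
    also have "\<dots> = ?M *v v"
      by (simp add: vec_eq_iff forall_3 matrix_vector_mult_def sum_3 algebra_simps)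
    finally show "L_map (2*m) A v = ?M *v v" .
  qed
  \<comment> \<open>Multiplication by \<open>?M\<close> is linear with matrix \<open>?M\<close>; the
    equivalence is \<open>nc\<close> translated back from \<open>X\<close>, \<open>Y\<close> to
    \<open>x\<close>, \<open>y\<close>.\<close>
  then show ?thesis
    using nc X_eq Y_eq X_Suc_eq Y_Suc_eq by (auto simp: matrix_vector_mul_linear)
qed

end
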